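(* Let $(\mathcal{M}, g, A)$ be a K\"ahler manifold of dimension $n$ with a quarter-symmetric metric $A$-connection $\overset{1}{\nabla}_XY=\overset{g}{\nabla}_XY-\pi(X)AY$ with generator $\pi$. The tensor $$\begin{aligned}\overset{0}{H}(X,Y)Z={}&\overset{0}{R}(X,Y)Z+\frac{1}{n-1}\big(\overset{0}{R}ic(X,Z)Y-\overset{0}{R}ic(Y,Z)X\big)-\frac{1}{2(n-1)}\big(\overset{1}{R}ic(X,Z)Y-\overset{1}{R}ic(Y,Z)X\big)\\&-\frac{1}{4(n-1)}\big(\overset{3}{R}ic(Z,X)Y-\overset{3}{R}ic(Z,Y)X+\overset{3}{'R}(AZ,AX)Y-\overset{3}{'R}(AZ,AY)X\big)\\&+\frac14\big(2\overset{1}{R}ic(Y,AX)AZ+\overset{3}{R}ic(Z,AX)AY-\overset{3}{R}ic(Z,AY)AX\big)\\&-\frac14\big(\overset{3}{'R}(AZ,X)AY-\overset{3}{'R}(AZ,Y)AX\big)\end{aligned}$$ is independent of the generator $\pi$; that is, for any two 1-forms $\pi,\tilde\pi$ on $\mathcal{M}$, the tensors $\overset{0}{H}$ constructed from $\pi$ and from $\tilde\pi$ coincide.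
   Context: A K\"ahler manifold $(\mathcal{M},g,A)$ is a Riemannian manifold $(\mathcal{M},g)$ of dimension $n=2k\ge4$ with a $(1,1)$ tensor field $A$ satisfying $A^2=-I$, $g(AX,AY)=g(X,Y)$ and $\overset{g}{\nabla}A=0$, where $\overset{g}{\nabla}$ is the Levi-Civita connection. $\overset{g}{R}$ is the Riemannian curvature tensor of $g$, $\overset{g}{R}(X,Y)Z=\overset{g}{\nabla}_X\overset{g}{\nabla}_YZ-\overset{g}{\nabla}_Y\overset{g}{\nabla}_XZ-\overset{g}{\nabla}_{[X,Y]}Z$. For a 1-form $\pi$ (the generator) put $$\overset{0}{D}(X,Y)=(\overset{g}{\nabla}_X\pi)(Y)+\tfrac12\pi(X)\pi(AY)+\tfrac12\pi(Y)\pi(AX),\quad \overset{1}{D}(X,Y)=(\overset{g}{\nabla}_X\pi)(Y)-(\overset{g}{\nabla}_Y\pi)(X),$$ $$\overset{2}{D}(X,Y)=(\overset{g}{\nabla}_X\pi)(Y)+\pi(Y)\pi(AX),\quad \overset{3}{D}(X,Y)=(\overset{g}{\nabla}_X\pi)(Y)+\pi(X)\pi(AY).$$ The curvature tensors of the zero, first and third kind are $$\overset{0}{R}(X,Y)Z=\overset{g}{R}(X,Y)Z-\tfrac12\big(\overset{0}{D}(X,Y)-\overset{0}{D}(Y,X)\big)AZ-\tfrac12\overset{0}{D}(X,Z)AY+\tfrac12\overset{0}{D}(Y,Z)AX+\tfrac14\pi(Z)\big(\pi(Y)X-\pi(X)Y\big),$$ $$\overset{1}{R}(X,Y)Z=\overset{g}{R}(X,Y)Z-\overset{1}{D}(X,Y)AZ,$$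 $$\overset{3}{R}(X,Y)Z=\overset{g}{R}(X,Y)Z-\overset{2}{D}(X,Y)AZ+\overset{3}{D}(Y,Z)AX.$$ For $\theta\in\{0,1,3\}$, $\overset{\theta}{R}ic(Y,Z)=\mathrm{Trace}\{X\mapsto\overset{\theta}{R}(X,Y)Z\}$, and $\overset{3}{'R}(X,Y)=\mathrm{Trace}\{Z\mapsto\overset{3}{R}(X,Y)Z\}$. *)

theory Defs
  imports "HOL-Analysis.Analysis" "HOL-Library.Function_Algebras"
begin

instantiation "fun" :: (type, real_vector) real_vector
begin

definition scaleR_fun_def: "a *\<^sub>R f = (\<lambda>x. a *\<^sub>R f x)"

instance
  by standard (auto simp: scaleR_fun_def fun_eq_iff scaleR_add_right scaleR_add_left)

end

text \<open>Only used for open sets \<open>S\<close>, where the derivative at a point is unambiguous.\<close>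

primrec ck_on :: "nat \<Rightarrow> ('a::real_normed_vector) set \<Rightarrow> ('a \<Rightarrow> 'b::real_normed_vector) \<Rightarrow> bool" where
  "ck_on 0 S f \<longleftrightarrow> continuous_on S f"
| "ck_on (Suc k) S f \<longleftrightarrow>
     f differentiable_on S \<and> (\<forall>v. ck_on k S (\<lambda>x. frechet_derivative f (at x) v))"

definition smooth_on :: "('a::real_normed_vector) set \<Rightarrow> ('a \<Rightarrow> 'b::real_normed_vector) \<Rightarrow> bool" where
  "smooth_on S f \<longleftrightarrow> (\<forall>k. ck_on k S f)"

definition linear_on :: "('a::real_vector) set \<Rightarrow> ('a \<Rightarrow> 'b::real_vector) \<Rightarrow> bool" where
  "linear_on S f \<longleftrightarrow>
     (\<forall>u\<in>S. \<forall>v\<in>S. f (u + v) = f u + f v) \<and> (\<forall>a. \<forall>u\<in>S. f (a *\<^sub>R u) = a *\<^sub>R f u)"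

section \<open>Smooth manifolds\<close>

text \<open>A chart is a pair of its domain and its coordinate map. A tangent vector at a point is the
  family of its components in all charts around that point, where the components transform by the
  derivative of the coordinate change. The family is normalised to zero at all other indices.\<close>

type_synonym ('m, 'n) chart = "'m set \<times> ('m \<Rightarrow> (real, 'n) vec)"
type_synonym ('m, 'n) tvec = "('m, 'n) chart \<Rightarrow> (real, 'n) vec"
type_synonym ('m, 'n) vfield = "'m \<Rightarrow> ('m, 'n) tvec"

definition chart_inv :: "('m, 'n::finite) chart \<Rightarrow> real^'n \<Rightarrow> 'm" where
  "chart_inv c = inv_into (fst c) (snd c)"

definition transition :: "('m, 'n::finite) chart \<Rightarrow> ('m, 'n) chart \<Rightarrow> real^'n \<Rightarrow> real^'n" where
  "transition c d = snd d \<circ> chart_inv c"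

definition smooth_manifold :: "'m topology \<Rightarrow> ('m, 'n::finite) chart set \<Rightarrow> bool" where
  "smooth_manifold M C \<longleftrightarrow>
     Hausdorff_space M \<and> second_countable M \<and> topspace M = (\<Union>c\<in>C. fst c) \<and>
     (\<forall>c\<in>C. openin M (fst c) \<and> open (snd c ` fst c) \<and>
        homeomorphic_map (subtopology M (fst c)) (top_of_set (snd c ` fst c)) (snd c)) \<and>
     (\<forall>c\<in>C. \<forall>d\<in>C. smooth_on (snd c ` (fst c \<inter> fst d)) (transition c d))"

definition charts_at :: "('m, 'n::finite) chart set \<Rightarrow> 'm \<Rightarrow> ('m, 'n) chart set" where
  "charts_at C p = {c \<in> C. p \<in> fst c}"

definition chart_of :: "('m, 'n::finite) chart set \<Rightarrow> 'm \<Rightarrow> ('m, 'n) chart" where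
  "chart_of C p = (SOME c. c \<in> charts_at C p)"

definition tangent_space :: "('m, 'n::finite) chart set \<Rightarrow> 'm \<Rightarrow> ('m, 'n) tvec set" where
  "tangent_space C p =
     {u. (\<forall>c. c \<notin> charts_at C p \<longrightarrow> u c = 0) \<and>
         (\<forall>c\<in>charts_at C p. \<forall>d\<in>charts_at C p.
            u d = frechet_derivative (transition c d) (at (snd c p)) (u c))}"

text \<open>The tangent vector at \<open>p\<close> whose components in the chart \<open>c\<close> are \<open>x\<close>.\<close>

definition tangent_of ::
  "('m, 'n::finite) chart set \<Rightarrow> 'm \<Rightarrow> ('m, 'n) chart \<Rightarrow> real^'n \<Rightarrow> ('m, 'n) tvec" where
  "tangent_of C p c x =
     (\<lambda>d. if d \<in> charts_at C p then frechet_derivative (transition c d) (at (snd c p)) x else 0)"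

text \<open>The trace of an endomorphism of the tangent space at \<open>p\<close>; it does not depend on the chart
  in which the matrix is taken.\<close>

definition tangent_trace ::
  "('m, 'n::finite) chart set \<Rightarrow> 'm \<Rightarrow> (('m, 'n) tvec \<Rightarrow> ('m, 'n) tvec) \<Rightarrow> real" where
  "tangent_trace C p f =
     (let c = chart_of C p in trace (matrix (\<lambda>x. f (tangent_of C p c x) c)))"

text \<open>Functions, vector fields and tensor fields are total functions; their values outside the open
  set \<open>V\<close> under consideration are irrelevant.\<close>

definition smooth_fun :: "('m, 'n::finite) chart set \<Rightarrow> 'm set \<Rightarrow> ('m \<Rightarrow> real) \<Rightarrow> bool" where
  "smooth_fun C V f \<longleftrightarrow> (\<forall>c\<in>C. smooth_on (snd c ` (V \<inter> fst c)) (f \<circ> chart_inv c))"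

definition vector_field :: "('m, 'n::finite) chart set \<Rightarrow> 'm set \<Rightarrow> ('m, 'n) vfield \<Rightarrow> bool" where
  "vector_field C V X \<longleftrightarrow>
     (\<forall>p\<in>V. X p \<in> tangent_space C p) \<and>
     (\<forall>c\<in>C. smooth_on (snd c ` (V \<inter> fst c)) ((\<lambda>p. X p c) \<circ> chart_inv c))"

text \<open>The function \<open>X f\<close>; its value does not depend on the chart used to compute it.\<close>

definition deriv_along ::
  "('m, 'n::finite) chart set \<Rightarrow> ('m, 'n) vfield \<Rightarrow> ('m \<Rightarrow> real) \<Rightarrow> 'm \<Rightarrow> real" where
  "deriv_along C X f p =
     (let c = chart_of C p in frechet_derivative (f \<circ> chart_inv c) (at (snd c p)) (X p c))"

definition bracket ::
  "('m, 'n::finite) chart set \<Rightarrow> ('m, 'n) vfield \<Rightarrow> ('m, 'n) vfield \<Rightarrow> ('m, 'n) vfield" where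
  "bracket C X Y p =
     (\<lambda>c. if c \<in> charts_at C p
          then frechet_derivative ((\<lambda>q. Y q c) \<circ> chart_inv c) (at (snd c p)) (X p c)
             - frechet_derivative ((\<lambda>q. X q c) \<circ> chart_inv c) (at (snd c p)) (Y p c)
          else 0)"

definition one_form ::
  "'m topology \<Rightarrow> ('m, 'n::finite) chart set \<Rightarrow> ('m \<Rightarrow> ('m, 'n) tvec \<Rightarrow> real) \<Rightarrow> bool" where
  "one_form M C \<pi> \<longleftrightarrow>
     (\<forall>p\<in>topspace M. linear_on (tangent_space C p) (\<pi> p)) \<and>
     (\<forall>V X. openin M V \<longrightarrow> vector_field C V X \<longrightarrow> smooth_fun C V (\<lambda>p. \<pi> p (X p)))"

definition tensor_11 ::
  "'m topology \<Rightarrow> ('m, 'n::finite) chart set \<Rightarrow> ('m \<Rightarrow> ('m, 'n) tvec \<Rightarrow> ('m, 'n) tvec) \<Rightarrow> bool" where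
  "tensor_11 M C A \<longleftrightarrow>
     (\<forall>p\<in>topspace M. linear_on (tangent_space C p) (A p) \<and>
        (\<forall>u\<in>tangent_space C p. A p u \<in> tangent_space C p)) \<and>
     (\<forall>V X. openin M V \<longrightarrow> vector_field C V X \<longrightarrow> vector_field C V (\<lambda>p. A p (X p)))"

definition riemannian_metric ::
  "'m topology \<Rightarrow> ('m, 'n::finite) chart set \<Rightarrow>
   ('m \<Rightarrow> ('m, 'n) tvec \<Rightarrow> ('m, 'n) tvec \<Rightarrow> real) \<Rightarrow> bool" where
  "riemannian_metric M C g \<longleftrightarrow>
     (\<forall>p\<in>topspace M. \<forall>u\<in>tangent_space C p.
        linear_on (tangent_space C p) (g p u) \<and>
        (\<forall>v\<in>tangent_space C p. g p u v = g p v u) \<and>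
        (u \<noteq> 0 \<longrightarrow> g p u u > 0)) \<and>
     (\<forall>V X Y. openin M V \<longrightarrow> vector_field C V X \<longrightarrow> vector_field C V Y \<longrightarrow>
        smooth_fun C V (\<lambda>p. g p (X p) (Y p)))"

section \<open>Connections and Kaehler manifolds\<close>

text \<open>A connection acts on vector fields over arbitrary open sets, compatibly with restriction
  (the second clause).\<close>

definition connection ::
  "'m topology \<Rightarrow> ('m, 'n::finite) chart set \<Rightarrow>
   (('m, 'n) vfield \<Rightarrow> ('m, 'n) vfield \<Rightarrow> ('m, 'n) vfield) \<Rightarrow> bool" where
  "connection M C N \<longleftrightarrow>
     (\<forall>V X Y. openin M V \<longrightarrow> vector_field C V X \<longrightarrow> vector_field C V Y \<longrightarrow>
        vector_field C V (N X Y) \<and>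
        (\<forall>X' Y'. (\<forall>p\<in>V. X' p = X p \<and> Y' p = Y p) \<longrightarrow> (\<forall>p\<in>V. N X' Y' p = N X Y p)) \<and>
        (\<forall>X'. vector_field C V X' \<longrightarrow> (\<forall>p\<in>V. N (X + X') Y p = N X Y p + N X' Y p)) \<and>
        (\<forall>Y'. vector_field C V Y' \<longrightarrow> (\<forall>p\<in>V. N X (Y + Y') p = N X Y p + N X Y' p)) \<and>
        (\<forall>f. smooth_fun C V f \<longrightarrow>
           (\<forall>p\<in>V. N (\<lambda>q. f q *\<^sub>R X q) Y p = f p *\<^sub>R N X Y p \<and>
              N X (\<lambda>q. f q *\<^sub>R Y q) p = deriv_along C X f p *\<^sub>R Y p + f p *\<^sub>R N X Y p)))"

definition levi_civita ::
  "'m topology \<Rightarrow> ('m, 'n::finite) chart set \<Rightarrow>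
   ('m \<Rightarrow> ('m, 'n) tvec \<Rightarrow> ('m, 'n) tvec \<Rightarrow> real) \<Rightarrow>
   (('m, 'n) vfield \<Rightarrow> ('m, 'n) vfield \<Rightarrow> ('m, 'n) vfield) \<Rightarrow> bool" where
  "levi_civita M C g N \<longleftrightarrow>
     connection M C N \<and>
     (\<forall>V X Y. openin M V \<longrightarrow> vector_field C V X \<longrightarrow> vector_field C V Y \<longrightarrow>
        (\<forall>p\<in>V. N X Y p - N Y X p = bracket C X Y p)) \<and>
     (\<forall>V X Y Z. openin M V \<longrightarrow> vector_field C V X \<longrightarrow> vector_field C V Y \<longrightarrow> vector_field C V Z \<longrightarrow>
        (\<forall>p\<in>V. deriv_along C X (\<lambda>q. g q (Y q) (Z q)) p
                = g p (N X Y p) (Z p) + g p (Y p) (N X Z p)))"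

text \<open>\<open>N\<close> is the Levi-Civita connection of \<open>g\<close>; the dimension is \<open>CARD('n)\<close>.\<close>

definition kaehler_manifold ::
  "'m topology \<Rightarrow> ('m, 'n::finite) chart set \<Rightarrow>
   ('m \<Rightarrow> ('m, 'n) tvec \<Rightarrow> ('m, 'n) tvec \<Rightarrow> real) \<Rightarrow>
   ('m \<Rightarrow> ('m, 'n) tvec \<Rightarrow> ('m, 'n) tvec) \<Rightarrow>
   (('m, 'n) vfield \<Rightarrow> ('m, 'n) vfield \<Rightarrow> ('m, 'n) vfield) \<Rightarrow> bool" where
  "kaehler_manifold M C g A N \<longleftrightarrow>
     smooth_manifold M C \<and> even CARD('n) \<and> CARD('n) \<ge> 4 \<and>
     riemannian_metric M C g \<and> levi_civita M C g N \<and> tensor_11 M C A \<and>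
     (\<forall>p\<in>topspace M. \<forall>u\<in>tangent_space C p. A p (A p u) = - u) \<and>
     (\<forall>p\<in>topspace M. \<forall>u\<in>tangent_space C p. \<forall>v\<in>tangent_space C p.
        g p (A p u) (A p v) = g p u v) \<and>
     (\<forall>V X Y. openin M V \<longrightarrow> vector_field C V X \<longrightarrow> vector_field C V Y \<longrightarrow>
        (\<forall>p\<in>V. N X (\<lambda>q. A q (Y q)) p - A p (N X Y p) = 0))"

text \<open>\<open>N1\<close> is the quarter-symmetric metric \<open>A\<close>-connection with generator \<open>\<pi>\<close>.\<close>

definition quarter_symmetric ::
  "'m topology \<Rightarrow> ('m, 'n::finite) chart set \<Rightarrow>
   ('m \<Rightarrow> ('m, 'n) tvec \<Rightarrow> ('m, 'n) tvec) \<Rightarrow>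
   (('m, 'n) vfield \<Rightarrow> ('m, 'n) vfield \<Rightarrow> ('m, 'n) vfield) \<Rightarrow>
   ('m \<Rightarrow> ('m, 'n) tvec \<Rightarrow> real) \<Rightarrow>
   (('m, 'n) vfield \<Rightarrow> ('m, 'n) vfield \<Rightarrow> ('m, 'n) vfield) \<Rightarrow> bool" where
  "quarter_symmetric M C A N \<pi> N1 \<longleftrightarrow>
     (\<forall>V X Y. openin M V \<longrightarrow> vector_field C V X \<longrightarrow> vector_field C V Y \<longrightarrow>
        (\<forall>p\<in>V. N1 X Y p = N X Y p - \<pi> p (X p) *\<^sub>R A p (Y p)))"

section \<open>Curvature tensors\<close>

definition curvature ::
  "('m, 'n::finite) chart set \<Rightarrow> (('m, 'n) vfield \<Rightarrow> ('m, 'n) vfield \<Rightarrow> ('m, 'n) vfield) \<Rightarrow>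
   ('m, 'n) vfield \<Rightarrow> ('m, 'n) vfield \<Rightarrow> ('m, 'n) vfield \<Rightarrow> ('m, 'n) vfield" where
  "curvature C N X Y Z = N X (N Y Z) - N Y (N X Z) - N (bracket C X Y) Z"

definition cov_deriv_form ::
  "('m, 'n::finite) chart set \<Rightarrow> (('m, 'n) vfield \<Rightarrow> ('m, 'n) vfield \<Rightarrow> ('m, 'n) vfield) \<Rightarrow>
   ('m \<Rightarrow> ('m, 'n) tvec \<Rightarrow> real) \<Rightarrow> ('m, 'n) vfield \<Rightarrow> ('m, 'n) vfield \<Rightarrow> 'm \<Rightarrow> real" where
  "cov_deriv_form C N \<pi> X Y p = deriv_along C X (\<lambda>q. \<pi> q (Y q)) p - \<pi> p (N X Y p)"

text \<open>The two expressions above are tensorial, so their values at \<open>p\<close> depend only on the values of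
  the vector fields at \<open>p\<close>. As tensors at \<open>p\<close> they are evaluated on the local extension of
  each tangent vector that is constant in a chart around \<open>p\<close>.\<close>

definition local_ext ::
  "('m, 'n::finite) chart set \<Rightarrow> 'm \<Rightarrow> ('m, 'n) tvec \<Rightarrow> ('m, 'n) vfield" where
  "local_ext C p u =
     (let c = chart_of C p in (\<lambda>q. if q \<in> fst c then tangent_of C q c (u c) else 0))"

definition riem ::
  "('m, 'n::finite) chart set \<Rightarrow> (('m, 'n) vfield \<Rightarrow> ('m, 'n) vfield \<Rightarrow> ('m, 'n) vfield) \<Rightarrow>
   'm \<Rightarrow> ('m, 'n) tvec \<Rightarrow> ('m, 'n) tvec \<Rightarrow> ('m, 'n) tvec \<Rightarrow> ('m, 'n) tvec" where
  "riem C N p X Y Z = curvature C N (local_ext C p X) (local_ext C p Y) (local_ext C p Z) p"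

definition nabla_form ::
  "('m, 'n::finite) chart set \<Rightarrow> (('m, 'n) vfield \<Rightarrow> ('m, 'n) vfield \<Rightarrow> ('m, 'n) vfield) \<Rightarrow>
   ('m \<Rightarrow> ('m, 'n) tvec \<Rightarrow> real) \<Rightarrow> 'm \<Rightarrow> ('m, 'n) tvec \<Rightarrow> ('m, 'n) tvec \<Rightarrow> real" where
  "nabla_form C N \<pi> p X Y = cov_deriv_form C N \<pi> (local_ext C p X) (local_ext C p Y) p"

text \<open>From here on \<open>X\<close>, \<open>Y\<close>, \<open>Z\<close> are tangent vectors at \<open>p\<close>.\<close>

locale quarter_symmetric_tensors =
  fixes C :: "('m, 'n::finite) chart set"
    and A :: "'m \<Rightarrow> ('m, 'n) tvec \<Rightarrow> ('m, 'n) tvec"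
    and N :: "('m, 'n) vfield \<Rightarrow> ('m, 'n) vfield \<Rightarrow> ('m, 'n) vfield"
    and \<pi> :: "'m \<Rightarrow> ('m, 'n) tvec \<Rightarrow> real"
begin

definition D0 :: "'m \<Rightarrow> ('m, 'n) tvec \<Rightarrow> ('m, 'n) tvec \<Rightarrow> real" where
  "D0 p X Y = nabla_form C N \<pi> p X Y + 1/2 * \<pi> p X * \<pi> p (A p Y) + 1/2 * \<pi> p Y * \<pi> p (A p X)"

definition D1 :: "'m \<Rightarrow> ('m, 'n) tvec \<Rightarrow> ('m, 'n) tvec \<Rightarrow> real" where
  "D1 p X Y = nabla_form C N \<pi> p X Y - nabla_form C N \<pi> p Y X"

definition D2 :: "'m \<Rightarrow> ('m, 'n) tvec \<Rightarrow> ('m, 'n) tvec \<Rightarrow> real" where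
  "D2 p X Y = nabla_form C N \<pi> p X Y + \<pi> p Y * \<pi> p (A p X)"

definition D3 :: "'m \<Rightarrow> ('m, 'n) tvec \<Rightarrow> ('m, 'n) tvec \<Rightarrow> real" where
  "D3 p X Y = nabla_form C N \<pi> p X Y + \<pi> p X * \<pi> p (A p Y)"

definition R0 :: "'m \<Rightarrow> ('m, 'n) tvec \<Rightarrow> ('m, 'n) tvec \<Rightarrow> ('m, 'n) tvec \<Rightarrow> ('m, 'n) tvec" where
  "R0 p X Y Z = riem C N p X Y Z
     - (1/2 * (D0 p X Y - D0 p Y X)) *\<^sub>R A p Z
     - (1/2 * D0 p X Z) *\<^sub>R A p Y
     + (1/2 * D0 p Y Z) *\<^sub>R A p X
     + (1/4 * \<pi> p Z) *\<^sub>R (\<pi> p Y *\<^sub>R X - \<pi> p X *\<^sub>R Y)"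

definition R1 :: "'m \<Rightarrow> ('m, 'n) tvec \<Rightarrow> ('m, 'n) tvec \<Rightarrow> ('m, 'n) tvec \<Rightarrow> ('m, 'n) tvec" where
  "R1 p X Y Z = riem C N p X Y Z - D1 p X Y *\<^sub>R A p Z"

definition R3 :: "'m \<Rightarrow> ('m, 'n) tvec \<Rightarrow> ('m, 'n) tvec \<Rightarrow> ('m, 'n) tvec \<Rightarrow> ('m, 'n) tvec" where
  "R3 p X Y Z = riem C N p X Y Z - D2 p X Y *\<^sub>R A p Z + D3 p Y Z *\<^sub>R A p X"

definition Ric0 :: "'m \<Rightarrow> ('m, 'n) tvec \<Rightarrow> ('m, 'n) tvec \<Rightarrow> real" where
  "Ric0 p Y Z = tangent_trace C p (\<lambda>X. R0 p X Y Z)"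

definition Ric1 :: "'m \<Rightarrow> ('m, 'n) tvec \<Rightarrow> ('m, 'n) tvec \<Rightarrow> real" where
  "Ric1 p Y Z = tangent_trace C p (\<lambda>X. R1 p X Y Z)"

definition Ric3 :: "'m \<Rightarrow> ('m, 'n) tvec \<Rightarrow> ('m, 'n) tvec \<Rightarrow> real" where
  "Ric3 p Y Z = tangent_trace C p (\<lambda>X. R3 p X Y Z)"

definition R3' :: "'m \<Rightarrow> ('m, 'n) tvec \<Rightarrow> ('m, 'n) tvec \<Rightarrow> real" where
  "R3' p X Y = tangent_trace C p (\<lambda>Z. R3 p X Y Z)"

definition H0 :: "'m \<Rightarrow> ('m, 'n) tvec \<Rightarrow> ('m, 'n) tvec \<Rightarrow> ('m, 'n) tvec \<Rightarrow> ('m, 'n) tvec" where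
  "H0 p X Y Z = (let n = real CARD('n) in
     R0 p X Y Z
     + (1 / (n - 1)) *\<^sub>R (Ric0 p X Z *\<^sub>R Y - Ric0 p Y Z *\<^sub>R X)
     - (1 / (2 * (n - 1))) *\<^sub>R (Ric1 p X Z *\<^sub>R Y - Ric1 p Y Z *\<^sub>R X)
     - (1 / (4 * (n - 1))) *\<^sub>R
         (Ric3 p Z X *\<^sub>R Y - Ric3 p Z Y *\<^sub>R X
          + R3' p (A p Z) (A p X) *\<^sub>R Y - R3' p (A p Z) (A p Y) *\<^sub>R X)
     + (1/4) *\<^sub>R
         ((2 * Ric1 p Y (A p X)) *\<^sub>R A p Z
          + Ric3 p Z (A p X) *\<^sub>R A p Y - Ric3 p Z (A p Y) *\<^sub>R A p X)
     - (1/4) *\<^sub>R (R3' p (A p Z) X *\<^sub>R A p Y - R3' p (A p Z) Y *\<^sub>R A p X))"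

end

end

theory Submission
  imports Defs
begin

text \<open>Since \<open>A\<close> is skew for \<open>g\<close>, its trace vanishes, and the trace of \<open>X \<mapsto> \<phi>(X) V\<close> is \<open>\<phi>(V)\<close>.
  Hence all Ricci-type traces of the three curvature tensors are explicit in \<open>\<nabla>\<pi>\<close>, \<open>\<pi>\<close> and the
  traces of the Levi-Civita curvature. Inserted into the tensor, every term containing \<open>\<pi>\<close> cancels
  in the coefficients of \<open>X\<close>, \<open>Y\<close>, \<open>AX\<close>, \<open>AY\<close> and \<open>AZ\<close>. No property of the Levi-Civita curvature
  enters; the analytic input is the bilinearity of \<open>\<nabla>\<pi>\<close> at a point, for which the
  chart-constant extensions of tangent vectors must be shown to be smooth vector fields.\<close>

section \<open>Functions of class $C^k$ on open sets\<close>

text \<open>\<open>frechet_derivative\<close> is a choice among the derivatives at the point.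
  Agreement near \<open>x\<close> makes the sets of derivatives equal, so the two choices coincide
  even where no derivative exists.\<close>

lemma frechet_derivative_cong_open:
  assumes "open S" "x \<in> S" "\<And>y. y \<in> S \<Longrightarrow> f y = g y"
  shows "frechet_derivative f (at x) = frechet_derivative g (at x)"
proof -
  have "(f has_derivative D) (at x) \<longleftrightarrow> (g has_derivative D) (at x)" for D
    using assms by (metis has_derivative_transform_within_open)
  then show ?thesis by (simp add: frechet_derivative_def)
qed

lemma ck_on_cong:
  assumes "open S" "\<And>x. x \<in> S \<Longrightarrow> f x = g x"
  shows "ck_on k S f \<longleftrightarrow> ck_on k S g"
  using assms(2)
proof (induction k arbitrary: f g)
  case 0
  then show ?case by (auto intro: continuous_on_cong)
next
  case (Suc k)
  have "f differentiable_on S \<longleftrightarrow> g differentiable_on S"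
    using Suc.prems has_derivative_transform unfolding differentiable_on_def differentiable_def
    by (metis (no_types, lifting))
  moreover have "ck_on k S (\<lambda>x. frechet_derivative f (at x) v) \<longleftrightarrow>
      ck_on k S (\<lambda>x. frechet_derivative g (at x) v)" for v
    by (rule Suc.IH) (metis Suc.prems assms(1) frechet_derivative_cong_open)
  ultimately show ?case by simp
qed

lemma ck_on_SucD: "ck_on (Suc k) S f \<Longrightarrow> ck_on k S f"
proof (induction k arbitrary: f)
  case 0
  then show ?case by (simp add: differentiable_imp_continuous_on)
next
  case (Suc k)
  from Suc.prems have "f differentiable_on S"
    and "\<And>v. ck_on (Suc k) S (\<lambda>x. frechet_derivative f (at x) v)" by simp_all
  then show ?case using Suc.IH by auto
qed

lemma ck_on_const: "ck_on k S (\<lambda>x. c)"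
  by (induction k arbitrary: c) (simp_all add: frechet_derivative_const)

lemma ck_on_has_derivative:
  assumes "ck_on (Suc k) S f" "open S" "x \<in> S"
  shows "(f has_derivative frechet_derivative f (at x)) (at x)"
  using assms by (simp add: differentiable_on_eq_differentiable_at frechet_derivative_works)

text \<open>Allows an explicit formula \<open>f'\<close> in place of
  \<open>frechet_derivative\<close>: on \<open>S\<close> both agree by uniqueness of derivatives.
  The closure lemmas for \<open>ck_on\<close> below follow this pattern.\<close>

lemma ck_on_SucI:
  assumes "open S" "\<And>x. x \<in> S \<Longrightarrow> (f has_derivative f' x) (at x)"
    and "\<And>v. ck_on k S (\<lambda>x. f' x v)"
  shows "ck_on (Suc k) S f"
proof -
  have "f differentiable_on S"
    using assms(2) by (meson differentiable_def differentiable_at_imp_differentiable_on)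
  moreover have "ck_on k S (\<lambda>x. frechet_derivative f (at x) v) \<longleftrightarrow> ck_on k S (\<lambda>x. f' x v)" for v
    using assms(1,2) by (intro ck_on_cong) (metis frechet_derivative_at)+
  ultimately show ?thesis using assms(3) by simp
qed

lemma ck_on_add:
  assumes "open S" "ck_on k S f" "ck_on k S g"
  shows "ck_on k S (\<lambda>x. f x + g x)"
  using assms(2,3)
proof (induction k arbitrary: f g)
  case 0
  then show ?case by (simp add: continuous_on_add)
next
  case (Suc k)
  show ?case
  proof (rule ck_on_SucI[OF assms(1)])
    show "((\<lambda>x. f x + g x) has_derivative
        (\<lambda>v. frechet_derivative f (at x) v + frechet_derivative g (at x) v)) (at x)" if "x \<in> S" for x
      by (intro has_derivative_add ck_on_has_derivative[OF Suc.prems(1) assms(1) that]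
          ck_on_has_derivative[OF Suc.prems(2) assms(1) that])
    show "ck_on k S (\<lambda>x. frechet_derivative f (at x) v + frechet_derivative g (at x) v)" for v
      using Suc.prems by (intro Suc.IH) simp_all
  qed
qed

lemma ck_on_sum:
  assumes "open S" "finite I" "\<And>i. i \<in> I \<Longrightarrow> ck_on k S (f i)"
  shows "ck_on k S (\<lambda>x. \<Sum>i\<in>I. f i x)"
  using assms(2,3) by (induction I) (simp_all add: ck_on_const ck_on_add assms(1))

text \<open>Induction on \<open>k\<close> by the product rule. Its terms mix a derivative with an
  undifferentiated factor, and the latter is brought down to order \<open>k\<close> by
  \<open>ck_on_SucD\<close>.\<close>

lemma ck_on_scaleR:
  assumes "open S" "ck_on k S h" "ck_on k S f"
  shows "ck_on k S (\<lambda>x. h x *\<^sub>R f x)"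
  using assms(2,3)
proof (induction k arbitrary: h f)
  case 0
  then show ?case by (simp add: continuous_on_scaleR)
next
  case (Suc k)
  show ?case
  proof (rule ck_on_SucI[OF assms(1)])
    show "((\<lambda>x. h x *\<^sub>R f x) has_derivative (\<lambda>v. h x *\<^sub>R frechet_derivative f (at x) v
        + frechet_derivative h (at x) v *\<^sub>R f x)) (at x)" if "x \<in> S" for x
      by (intro has_derivative_scaleR ck_on_has_derivative[OF Suc.prems(1) assms(1) that]
          ck_on_has_derivative[OF Suc.prems(2) assms(1) that])
    show "ck_on k S (\<lambda>x. h x *\<^sub>R frechet_derivative f (at x) v
        + frechet_derivative h (at x) v *\<^sub>R f x)" for v
      using Suc.prems ck_on_SucD[OF Suc.prems(1)] ck_on_SucD[OF Suc.prems(2)]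
      by (intro ck_on_add assms(1) Suc.IH) simp_all
  qed
qed

lemma ck_on_inner_const:
  assumes "open S" "ck_on k S f"
  shows "ck_on k S (\<lambda>x. f x \<bullet> b)"
  using assms(2)
proof (induction k arbitrary: f)
  case 0
  then show ?case by (simp add: continuous_on_inner)
next
  case (Suc k)
  show ?case
  proof (rule ck_on_SucI[OF assms(1)])
    show "((\<lambda>x. f x \<bullet> b) has_derivative (\<lambda>v. frechet_derivative f (at x) v \<bullet> b)) (at x)"
      if "x \<in> S" for x
      by (intro has_derivative_inner_left ck_on_has_derivative[OF Suc.prems assms(1) that])
    show "ck_on k S (\<lambda>x. frechet_derivative f (at x) v \<bullet> b)" for v
      using Suc.prems by (intro Suc.IH) simp
  qed
qed

text \<open>In the chain rule the direction fed to the derivative of \<open>f\<close> varies with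
  \<open>x\<close>, while \<open>ck_on\<close> controls fixed directions only. Expanding the
  direction in the finite basis of the middle space gives a sum of products to which the induction
  hypothesis applies; \<open>f\<close> is then replaced by its directional derivatives while
  \<open>g\<close> stays.\<close>

lemma ck_on_compose:
  fixes g :: "'a::real_normed_vector \<Rightarrow> 'b::euclidean_space"
  assumes "open S" "open T" "g ` S \<subseteq> T" "ck_on k S g" "ck_on k T f"
  shows "ck_on k S (f \<circ> g)"
  using assms(4,5)
proof (induction k arbitrary: f)
  case 0
  then show ?case
    using assms(3) unfolding ck_on.simps by (meson continuous_on_compose continuous_on_subset)
next
  case (Suc k)
  show ?case
  proof (rule ck_on_SucI[OF assms(1)])
    fix x assume x: "x \<in> S"
    then have gx: "g x \<in> T" using assms(3) by auto
    note Df = ck_on_has_derivative[OF Suc.prems(2) assms(2) gx]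
    have *: "(\<Sum>b\<in>Basis. (w \<bullet> b) *\<^sub>R frechet_derivative f (at (g x)) b)
        = frechet_derivative f (at (g x)) w" for w
    proof -
      have "linear (frechet_derivative f (at (g x)))"
        by (rule has_derivative_linear[OF Df])
      then have "(\<Sum>b\<in>Basis. (w \<bullet> b) *\<^sub>R frechet_derivative f (at (g x)) b)
          = frechet_derivative f (at (g x)) (\<Sum>b\<in>Basis. (w \<bullet> b) *\<^sub>R b)"
        by (simp add: linear_sum linear_scale)
      then show ?thesis by (simp add: euclidean_representation)
    qed
    show "((f \<circ> g) has_derivative (\<lambda>v. \<Sum>b\<in>Basis. (frechet_derivative g (at x) v \<bullet> b) *\<^sub>R
        frechet_derivative f (at (g x)) b)) (at x)"
      using diff_chain_at[OF ck_on_has_derivative[OF Suc.prems(1) assms(1) x] Df]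
      by (simp only: * comp_def)
  next
    fix v
    have "ck_on k S ((\<lambda>y. frechet_derivative f (at y) b) \<circ> g)" for b
      using Suc.prems by (intro Suc.IH ck_on_SucD[OF Suc.prems(1)]) simp
    then show "ck_on k S (\<lambda>x. \<Sum>b\<in>Basis. (frechet_derivative g (at x) v \<bullet> b) *\<^sub>R
        frechet_derivative f (at (g x)) b)"
      using Suc.prems
      by (intro ck_on_sum ck_on_scaleR assms(1) ck_on_inner_const) (simp_all add: comp_def)
  qed
qed

lemma smooth_on_cong:
  "open S \<Longrightarrow> (\<And>x. x \<in> S \<Longrightarrow> f x = g x) \<Longrightarrow> smooth_on S f \<longleftrightarrow> smooth_on S g"
  unfolding smooth_on_def by (intro all_cong1 ck_on_cong)

lemma smooth_on_compose:
  fixes g :: "'a::real_normed_vector \<Rightarrow> 'b::euclidean_space"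
  assumes "open S" "open T" "g ` S \<subseteq> T" "smooth_on S g" "smooth_on T f"
  shows "smooth_on S (f \<circ> g)"
  using assms by (simp add: smooth_on_def ck_on_compose)

lemma smooth_on_frechet_derivative:
  "smooth_on S f \<Longrightarrow> smooth_on S (\<lambda>x. frechet_derivative f (at x) v)"
  by (metis ck_on.simps(2) smooth_on_def)

lemma smooth_on_const: "smooth_on S (\<lambda>x. c)"
  by (simp add: smooth_on_def ck_on_const)

lemma smooth_on_imp_differentiable:
  assumes "smooth_on S f" "open S" "x \<in> S"
  shows "f differentiable (at x)"
proof -
  have "ck_on (Suc 0) S f" using assms(1) unfolding smooth_on_def by blast
  then show ?thesis using assms(2,3) by (simp add: differentiable_on_eq_differentiable_at)
qed

section \<open>Tangent vectors\<close>

lemma scaleR_fun_apply: "(a *\<^sub>R f) x = a *\<^sub>R f x"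
  by (simp only: scaleR_fun_def)

lemma linear_on_add: "linear_on S f \<Longrightarrow> u \<in> S \<Longrightarrow> v \<in> S \<Longrightarrow> f (u + v) = f u + f v"
  by (simp add: linear_on_def)

lemma linear_on_scaleR: "linear_on S f \<Longrightarrow> u \<in> S \<Longrightarrow> f (a *\<^sub>R u) = a *\<^sub>R f u"
  by (simp add: linear_on_def)

lemma linear_on_diff:
  "linear_on S f \<Longrightarrow> linear_on S h \<Longrightarrow> linear_on S (\<lambda>u. f u - h u)"
  by (simp add: linear_on_def scaleR_diff_right)

lemma linear_on_mult:
  "linear_on S f \<Longrightarrow> linear_on S (\<lambda>u. (a::real) * f u)"
  by (simp add: linear_on_def algebra_simps)

lemma linear_on_uminus: "linear_on S f \<Longrightarrow> u \<in> S \<Longrightarrow> f (- u) = - f u"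
  using linear_on_scaleR[of S f u "- 1"] by simp

locale manifold =
  fixes M :: "'m topology" and C :: "('m, 'n::finite) chart set"
  assumes smooth_manifold: "smooth_manifold M C"
begin

section \<open>Charts and the derivatives of coordinate changes\<close>

lemma chart_openin: "c \<in> C \<Longrightarrow> openin M (fst c)"
  using smooth_manifold by (auto simp: smooth_manifold_def)

lemma chart_inj: "c \<in> C \<Longrightarrow> inj_on (snd c) (fst c)"
proof -
  assume c: "c \<in> C"
  then have "homeomorphic_map (subtopology M (fst c)) (top_of_set (snd c ` fst c)) (snd c)"
    using smooth_manifold by (auto simp: smooth_manifold_def)
  then have "inj_on (snd c) (topspace (subtopology M (fst c)))"
    by (rule homeomorphic_imp_injective_map)
  then show ?thesis
    using openin_subset[OF chart_openin[OF c]] by (simp add: Int_absorb1)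
qed

lemma chart_image_open:
  assumes "c \<in> C" "openin M V"
  shows "open (snd c ` (V \<inter> fst c))"
proof -
  have h: "homeomorphic_map (subtopology M (fst c)) (top_of_set (snd c ` fst c)) (snd c)"
    and o: "open (snd c ` fst c)"
    using smooth_manifold assms by (auto simp: smooth_manifold_def)
  have "openin (subtopology M (fst c)) (V \<inter> fst c)"
    using assms by (simp add: openin_subtopology_Int)
  then have "openin (top_of_set (snd c ` fst c)) (snd c ` (V \<inter> fst c))"
    using homeomorphic_imp_open_map[OF h] unfolding open_map_def by blast
  then show ?thesis using o by (simp add: openin_open_eq)
qed

lemma chart_inv_chart: "c \<in> C \<Longrightarrow> q \<in> fst c \<Longrightarrow> chart_inv c (snd c q) = q"
  by (simp add: chart_inv_def chart_inj)

lemma transition_chart: "c \<in> C \<Longrightarrow> q \<in> fst c \<Longrightarrow> transition c d (snd c q) = snd d q"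
  by (simp add: transition_def chart_inv_chart)

lemma overlap_open: "c \<in> C \<Longrightarrow> d \<in> C \<Longrightarrow> open (snd c ` (fst c \<inter> fst d))"
  by (metis chart_image_open chart_openin inf_commute)

lemma smooth_transition:
  "c \<in> C \<Longrightarrow> d \<in> C \<Longrightarrow> smooth_on (snd c ` (fst c \<inter> fst d)) (transition c d)"
  using smooth_manifold by (auto simp: smooth_manifold_def)

lemma transition_differentiable:
  assumes "c \<in> charts_at C p" "d \<in> charts_at C p"
  shows "transition c d differentiable (at (snd c p))"
  using assms
  by (intro smooth_on_imp_differentiable[OF smooth_transition overlap_open])
    (auto simp: charts_at_def)

lemma linear_transition_deriv:
  "c \<in> charts_at C p \<Longrightarrow> d \<in> charts_at C p \<Longrightarrow>
    linear (frechet_derivative (transition c d) (at (snd c p)))"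
  by (simp add: transition_differentiable linear_frechet_derivative)

text \<open>The cocycle rule, from the chain rule. The composite coordinate change is compared with
  the direct one on the image of the triple overlap, an open neighbourhood of
  \<open>snd b p\<close>, which suffices for derivatives there.\<close>

lemma transition_deriv_comp:
  assumes "b \<in> charts_at C p" "c \<in> charts_at C p" "d \<in> charts_at C p"
  shows "frechet_derivative (transition c d) (at (snd c p))
      (frechet_derivative (transition b c) (at (snd b p)) x)
    = frechet_derivative (transition b d) (at (snd b p)) x"
proof -
  have mem: "b \<in> C" "c \<in> C" "d \<in> C" "p \<in> fst b" "p \<in> fst c" "p \<in> fst d"
    using assms by (auto simp: charts_at_def)
  let ?S = "snd b ` (fst c \<inter> fst d \<inter> fst b)"
  have S: "open ?S" "snd b p \<in> ?S"
    using mem by (auto intro!: chart_image_open openin_Int chart_openin)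
  have "(transition b c has_derivative frechet_derivative (transition b c) (at (snd b p)))
      (at (snd b p))"
    using assms transition_differentiable frechet_derivative_works by blast
  moreover have "(transition c d has_derivative frechet_derivative (transition c d) (at (snd c p)))
      (at (transition b c (snd b p)))"
    using assms mem transition_differentiable frechet_derivative_works transition_chart by metis
  ultimately have "((transition c d \<circ> transition b c) has_derivative
      (frechet_derivative (transition c d) (at (snd c p)) \<circ>
       frechet_derivative (transition b c) (at (snd b p)))) (at (snd b p))"
    by (rule diff_chain_at)
  then have "frechet_derivative (transition c d) (at (snd c p)) \<circ>
       frechet_derivative (transition b c) (at (snd b p))
      = frechet_derivative (transition c d \<circ> transition b c) (at (snd b p))"
    by (rule frechet_derivative_at)
  also have "\<dots> = frechet_derivative (transition b d) (at (snd b p))"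
    by (rule frechet_derivative_cong_open[OF S]) (auto simp: transition_chart mem)
  finally show ?thesis by (metis comp_apply)
qed

lemma transition_deriv_self:
  assumes "c \<in> charts_at C p"
  shows "frechet_derivative (transition c c) (at (snd c p)) x = x"
proof -
  have mem: "c \<in> C" "p \<in> fst c" using assms by (auto simp: charts_at_def)
  have "frechet_derivative (transition c c) (at (snd c p))
      = frechet_derivative (\<lambda>y. y) (at (snd c p))"
    by (rule frechet_derivative_cong_open[OF overlap_open[of c c]])
      (use mem in \<open>auto simp: transition_chart\<close>)
  then show ?thesis by simp
qed

lemma tangent_of_mem: "c \<in> charts_at C p \<Longrightarrow> tangent_of C p c x \<in> tangent_space C p"
  by (auto simp: tangent_of_def tangent_space_def transition_deriv_comp)

lemma tangent_of_self: "c \<in> charts_at C p \<Longrightarrow> tangent_of C p c x c = x"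
  by (simp add: tangent_of_def transition_deriv_self)

lemma tangent_space_transition:
  "u \<in> tangent_space C p \<Longrightarrow> c \<in> charts_at C p \<Longrightarrow> d \<in> charts_at C p \<Longrightarrow>
    frechet_derivative (transition c d) (at (snd c p)) (u c) = u d"
  unfolding tangent_space_def
  by (drule CollectD, drule conjunct2, drule (1) bspec, drule (1) bspec, erule sym)

text \<open>Together with \<open>tangent_of_self\<close> this identifies the tangent space with
  coordinate space. At indices that are not charts around \<open>p\<close>, equality comes from the
  normalisation to zero.\<close>

lemma tangent_of_component:
  assumes "c \<in> charts_at C p" "u \<in> tangent_space C p"
  shows "tangent_of C p c (u c) = u"
proof
  fix d
  have "d \<notin> charts_at C p \<Longrightarrow> u d = 0"
    using assms(2) unfolding tangent_space_def by (drule_tac CollectD) blast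
  then show "tangent_of C p c (u c) d = u d"
    using tangent_space_transition[OF assms(2,1)] by (simp add: tangent_of_def)
qed

lemma tangent_of_add:
  "c \<in> charts_at C p \<Longrightarrow> tangent_of C p c (x + y) = tangent_of C p c x + tangent_of C p c y"
  by (auto simp: tangent_of_def fun_eq_iff linear_transition_deriv linear_add)

lemma tangent_of_scaleR:
  "c \<in> charts_at C p \<Longrightarrow> tangent_of C p c (a *\<^sub>R x) = a *\<^sub>R tangent_of C p c x"
  by (auto simp: tangent_of_def fun_eq_iff scaleR_fun_def linear_transition_deriv linear_scale)

lemma tangent_of_eq_0_iff: "c \<in> charts_at C p \<Longrightarrow> tangent_of C p c x = 0 \<longleftrightarrow> x = 0"
  by (metis scaleR_zero_left tangent_of_scaleR tangent_of_self zero_fun_apply)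

section \<open>Chart-constant extensions of tangent vectors\<close>

lemma chart_of_mem:
  assumes "p \<in> topspace M"
  shows "chart_of C p \<in> charts_at C p"
proof -
  have "\<exists>c. c \<in> charts_at C p"
    using assms smooth_manifold by (auto simp: smooth_manifold_def charts_at_def)
  then show ?thesis unfolding chart_of_def by (rule someI_ex)
qed

text \<open>In the coordinates of another chart \<open>d\<close>, the components are the derivative
  of \<open>transition c d\<close> in the fixed direction \<open>x\<close>, composed with
  \<open>transition d c\<close>. Both maps are smooth on the overlap.\<close>

lemma vector_field_tangent_of:
  assumes "c \<in> C"
  shows "vector_field C (fst c) (\<lambda>q. if q \<in> fst c then tangent_of C q c x else 0)"
proof -
  have "smooth_on (snd d ` (fst c \<inter> fst d))
      ((\<lambda>q. (if q \<in> fst c then tangent_of C q c x else 0) d) \<circ> chart_inv d)" if d: "d \<in> C" for d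
  proof -
    let ?S = "snd d ` (fst c \<inter> fst d)" and ?T = "snd c ` (fst c \<inter> fst d)"
    have S: "open ?S" "open ?T" "smooth_on ?S (transition d c)"
      using d assms overlap_open smooth_transition by (metis inf_commute)+
    have "smooth_on ?S ((\<lambda>z. frechet_derivative (transition c d) (at z) x) \<circ> transition d c)"
    proof (rule smooth_on_compose[OF S(1,2) _ S(3)])
      show "transition d c ` ?S \<subseteq> ?T" using d by (auto simp: transition_chart)
      show "smooth_on ?T (\<lambda>z. frechet_derivative (transition c d) (at z) x)"
        by (intro smooth_on_frechet_derivative smooth_transition d assms)
    qed
    then show ?thesis
      by (rule iffD1[OF smooth_on_cong[OF S(1)], rotated])
        (use d in \<open>auto simp: transition_chart chart_inv_chart tangent_of_def charts_at_def\<close>)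
  qed
  then show ?thesis
    using assms by (auto simp: vector_field_def tangent_of_mem charts_at_def)
qed

lemma chart_deriv_differentiable:
  assumes "smooth_fun C V f" "openin M V" "p \<in> V" "c \<in> charts_at C p"
  shows "(f \<circ> chart_inv c) differentiable (at (snd c p))"
  using assms
  by (intro smooth_on_imp_differentiable[of "snd c ` (V \<inter> fst c)"] chart_image_open)
    (auto simp: smooth_fun_def charts_at_def)

lemma smooth_fun_const: "smooth_fun C V (\<lambda>p. a)"
  by (simp add: smooth_fun_def smooth_on_const comp_def)

lemma local_ext_vector_field:
  "p \<in> topspace M \<Longrightarrow> vector_field C (fst (chart_of C p)) (local_ext C p u)"
  using vector_field_tangent_of[of "chart_of C p"] chart_of_mem[of p]
  by (simp add: local_ext_def charts_at_def Let_def)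

lemma local_ext_add:
  assumes "p \<in> topspace M"
  shows "local_ext C p (u + v) = local_ext C p u + local_ext C p v"
  using tangent_of_add chart_of_mem[OF assms]
  by (auto simp: local_ext_def Let_def charts_at_def fun_eq_iff)

lemma local_ext_scaleR:
  assumes "p \<in> topspace M"
  shows "local_ext C p (a *\<^sub>R u) = (\<lambda>q. a *\<^sub>R local_ext C p u q)"
proof
  fix q
  have "q \<in> fst (chart_of C p) \<Longrightarrow> chart_of C p \<in> charts_at C q"
    using chart_of_mem[OF assms] by (simp add: charts_at_def)
  then show "local_ext C p (a *\<^sub>R u) q = a *\<^sub>R local_ext C p u q"
    by (simp add: local_ext_def Let_def tangent_of_scaleR scaleR_fun_apply)
qed

section \<open>Derivatives of functions along vector fields\<close>

lemma deriv_along_cong: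
  assumes "openin M V" "p \<in> V" "\<And>q. q \<in> V \<Longrightarrow> f q = h q"
  shows "deriv_along C X f p = deriv_along C X h p"
proof -
  have "p \<in> topspace M" using assms(1,2) openin_subset by blast
  then have c: "chart_of C p \<in> C" "p \<in> fst (chart_of C p)"
    using chart_of_mem by (auto simp: charts_at_def)
  have "frechet_derivative (f \<circ> chart_inv (chart_of C p)) (at (snd (chart_of C p) p))
      = frechet_derivative (h \<circ> chart_inv (chart_of C p)) (at (snd (chart_of C p) p))"
    by (rule frechet_derivative_cong_open[OF chart_image_open[OF c(1) assms(1)]])
      (use c assms in \<open>auto simp: chart_inv_chart\<close>)
  then show ?thesis by (simp add: deriv_along_def Let_def)
qed

lemma deriv_along_has_derivative:
  assumes "smooth_fun C V f" "openin M V" "p \<in> V"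
  shows "((f \<circ> chart_inv (chart_of C p)) has_derivative
    frechet_derivative (f \<circ> chart_inv (chart_of C p)) (at (snd (chart_of C p) p)))
    (at (snd (chart_of C p) p))"
proof -
  have "p \<in> topspace M" using assms(2,3) openin_subset by blast
  then show ?thesis
    using chart_deriv_differentiable[OF assms chart_of_mem] frechet_derivative_works by blast
qed

lemma deriv_along_add:
  assumes "smooth_fun C V f" "smooth_fun C V h" "openin M V" "p \<in> V"
  shows "deriv_along C X (\<lambda>q. f q + h q) p = deriv_along C X f p + deriv_along C X h p"
  using frechet_derivative_at[OF has_derivative_add[OF
      deriv_along_has_derivative[OF assms(1,3,4)] deriv_along_has_derivative[OF assms(2,3,4)]]]
  by (simp add: deriv_along_def Let_def comp_def fun_eq_iff)

lemma deriv_along_mult: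
  assumes "smooth_fun C V f" "openin M V" "p \<in> V"
  shows "deriv_along C X (\<lambda>q. a * f q) p = a * deriv_along C X f p"
  using frechet_derivative_at[OF has_derivative_mult_right[OF
      deriv_along_has_derivative[OF assms(1,2,3)], of a]]
  by (simp add: deriv_along_def Let_def comp_def fun_eq_iff)

lemma deriv_along_const: "deriv_along C X (\<lambda>q. a) p = 0"
  by (simp add: deriv_along_def Let_def comp_def)

text \<open>Only the value of the field at \<open>p\<close> enters. The two-term combination covers
  additivity (\<open>a = b = 1\<close>) and homogeneity (\<open>b = 0\<close>) at once.\<close>

lemma deriv_along_linear:
  assumes "smooth_fun C V f" "openin M V" "p \<in> V"
    and "X p = a *\<^sub>R Y p + b *\<^sub>R Z p"
  shows "deriv_along C X f p = a * deriv_along C Y f p + b * deriv_along C Z f p"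
proof -
  note lin = has_derivative_linear[OF deriv_along_has_derivative[OF assms(1-3)]]
  show ?thesis
    by (simp add: deriv_along_def Let_def assms(4) scaleR_fun_apply linear_add[OF lin]
        linear_scale[OF lin])
qed

section \<open>Traces\<close>

text \<open>This and the next two lemmas hold for arbitrary maps, linear or not: the trace is a sum
  of diagonal entries, which depend only on the values at the chart basis vectors.\<close>

lemma tangent_trace_add:
  "tangent_trace C p (\<lambda>X. f X + h X) = tangent_trace C p f + tangent_trace C p h"
  by (simp add: tangent_trace_def Let_def trace_def matrix_def sum.distrib)

lemma tangent_trace_diff:
  "tangent_trace C p (\<lambda>X. f X - h X) = tangent_trace C p f - tangent_trace C p h"
  by (simp add: tangent_trace_def Let_def trace_def matrix_def sum_subtractf)

lemma tangent_trace_scaleR: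
  "tangent_trace C p (\<lambda>X. a *\<^sub>R f X) = a * tangent_trace C p f"
  by (simp add: tangent_trace_def Let_def trace_def matrix_def scaleR_fun_apply sum_distrib_left)

lemma tangent_trace_id:
  assumes "p \<in> topspace M"
  shows "tangent_trace C p (\<lambda>X. X) = real CARD('n)"
  by (simp add: tangent_trace_def Let_def trace_def matrix_def tangent_of_self
      chart_of_mem[OF assms])

lemma linear_tangent_of:
  fixes \<phi> :: "('m, 'n) tvec \<Rightarrow> 'b::real_vector"
  assumes "c \<in> charts_at C p" "linear_on (tangent_space C p) \<phi>"
  shows "linear (\<lambda>x. \<phi> (tangent_of C p c x))"
  using assms
  by (intro linearI)
    (simp_all add: tangent_of_add tangent_of_scaleR tangent_of_mem linear_on_add linear_on_scaleR)

text \<open>In the chart basis the diagonal entries are \<open>\<phi>\<close> of the basis vectors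
  times the components of \<open>V\<close>; by linearity their sum is
  \<open>\<phi> V\<close>.\<close>

lemma tangent_trace_rank_one:
  assumes "p \<in> topspace M" "linear_on (tangent_space C p) \<phi>" "V \<in> tangent_space C p"
  shows "tangent_trace C p (\<lambda>X. \<phi> X *\<^sub>R V) = \<phi> V"
proof -
  let ?c = "chart_of C p"
  note c = chart_of_mem[OF assms(1)]
  note lin = linear_tangent_of[OF c assms(2)]
  have "\<phi> V = \<phi> (tangent_of C p ?c (\<Sum>i\<in>UNIV. V ?c $ i *\<^sub>R axis i 1))"
    using basis_expansion[of "V ?c"] tangent_of_component[OF c assms(3)]
    by (simp add: scalar_mult_eq_scaleR)
  also have "\<dots> = (\<Sum>i\<in>UNIV. V ?c $ i * \<phi> (tangent_of C p ?c (axis i 1)))"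
    by (simp add: linear_sum[OF lin] linear_scale[OF lin])
  also have "\<dots> = tangent_trace C p (\<lambda>X. \<phi> X *\<^sub>R V)"
    by (simp add: tangent_trace_def Let_def trace_def matrix_def scaleR_fun_apply mult.commute)
  finally show ?thesis by simp
qed

end

text \<open>Conjugation by \<open>G\<close> turns \<open>J\<close> into minus its transpose. The
  trace is invariant under both conjugation and transposition, hence equals its own
  negative.\<close>

lemma trace_eq_0_if_skew:
  fixes J G :: "real^'n^'n"
  assumes "invertible G" "G ** J = - (transpose J ** G)"
  shows "trace J = 0"
proof -
  obtain H where H: "G ** H = mat 1" "H ** G = mat 1"
    using assms(1) by (auto simp: invertible_def)
  have "trace J = trace (H ** (G ** J))"
    by (simp add: matrix_mul_assoc H)
  also have "\<dots> = trace ((G ** J) ** H)"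
    by (rule trace_mul_sym)
  also have "\<dots> = - trace (transpose J ** G ** H)"
    unfolding assms(2) by (simp add: trace_def matrix_matrix_mult_def sum_negf)
  also have "transpose J ** G ** H = transpose J"
    by (simp add: matrix_mul_assoc[symmetric] H)
  also have "trace (transpose J) = trace J"
    by (simp add: trace_def transpose_def)
  finally show ?thesis by simp
qed

section \<open>The curvature tensors at a point\<close>

text \<open>Fixes a single generator. The theorem instantiates it once for each of the two
  generators over the same Kaehler manifold.\<close>

locale kaehler_one_form = manifold M C + quarter_symmetric_tensors C A N \<pi>
  for M :: "'m topology" and C :: "('m, 'n::finite) chart set"
    and A :: "'m \<Rightarrow> ('m, 'n) tvec \<Rightarrow> ('m, 'n) tvec"
    and N :: "('m, 'n) vfield \<Rightarrow> ('m, 'n) vfield \<Rightarrow> ('m, 'n) vfield"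
    and \<pi> :: "'m \<Rightarrow> ('m, 'n) tvec \<Rightarrow> real" +
  fixes g :: "'m \<Rightarrow> ('m, 'n) tvec \<Rightarrow> ('m, 'n) tvec \<Rightarrow> real"
  assumes kaehler: "kaehler_manifold M C g A N" and one_form: "one_form M C \<pi>"
begin

section \<open>Consequences of the Kaehler and one-form axioms\<close>

lemma connection: "connection M C N"
  using kaehler by (simp add: kaehler_manifold_def levi_civita_def)

lemma
  assumes "openin M V" "vector_field C V X" "vector_field C V Y"
  shows N_vector_field: "vector_field C V (N X Y)"
    and N_add_left: "vector_field C V X' \<Longrightarrow> p \<in> V \<Longrightarrow> N (X + X') Y p = N X Y p + N X' Y p"
    and N_add_right: "vector_field C V Y' \<Longrightarrow> p \<in> V \<Longrightarrow> N X (Y + Y') p = N X Y p + N X Y' p"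
    and N_scaleR_left: "p \<in> V \<Longrightarrow> N (\<lambda>q. a *\<^sub>R X q) Y p = a *\<^sub>R N X Y p"
    and N_scaleR_right: "p \<in> V \<Longrightarrow> N X (\<lambda>q. a *\<^sub>R Y q) p = a *\<^sub>R N X Y p"
proof -
  note * = connection[unfolded connection_def, rule_format, OF assms]
  show "vector_field C V (N X Y)"
    and "vector_field C V X' \<Longrightarrow> p \<in> V \<Longrightarrow> N (X + X') Y p = N X Y p + N X' Y p"
    and "vector_field C V Y' \<Longrightarrow> p \<in> V \<Longrightarrow> N X (Y + Y') p = N X Y p + N X Y' p"
    using * by blast+
  \<comment> \<open>Constants are smooth functions with vanishing derivative, so the Leibniz term
    disappears and real homogeneity remains in both arguments.\<close>
  have "smooth_fun C V (\<lambda>q. a)" by (rule smooth_fun_const)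
  then have "\<forall>p\<in>V. N (\<lambda>q. a *\<^sub>R X q) Y p = a *\<^sub>R N X Y p \<and>
      N X (\<lambda>q. a *\<^sub>R Y q) p = deriv_along C X (\<lambda>q. a) p *\<^sub>R Y p + a *\<^sub>R N X Y p"
    using * by blast
  then show "p \<in> V \<Longrightarrow> N (\<lambda>q. a *\<^sub>R X q) Y p = a *\<^sub>R N X Y p"
    and "p \<in> V \<Longrightarrow> N X (\<lambda>q. a *\<^sub>R Y q) p = a *\<^sub>R N X Y p"
    by (simp_all add: deriv_along_const)
qed

lemma form_linear: "p \<in> topspace M \<Longrightarrow> linear_on (tangent_space C p) (\<pi> p)"
  using one_form by (simp add: one_form_def)

lemma form_smooth:
  "openin M V \<Longrightarrow> vector_field C V X \<Longrightarrow> smooth_fun C V (\<lambda>p. \<pi> p (X p))"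
  using one_form by (simp add: one_form_def)

lemma vector_field_at: "vector_field C V X \<Longrightarrow> p \<in> V \<Longrightarrow> X p \<in> tangent_space C p"
  by (simp add: vector_field_def)

lemma A_linear: "p \<in> topspace M \<Longrightarrow> linear_on (tangent_space C p) (A p)"
  and A_mem: "p \<in> topspace M \<Longrightarrow> u \<in> tangent_space C p \<Longrightarrow> A p u \<in> tangent_space C p"
  using kaehler by (simp_all add: kaehler_manifold_def tensor_11_def)

lemma A_A: "p \<in> topspace M \<Longrightarrow> u \<in> tangent_space C p \<Longrightarrow> A p (A p u) = - u"
  using kaehler by (simp add: kaehler_manifold_def)

context
  fixes p
  assumes p: "p \<in> topspace M"
begin

abbreviation "V \<equiv> fst (chart_of C p)"
abbreviation "E \<equiv> local_ext C p"
abbreviation "nab \<equiv> nabla_form C N \<pi> p"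

section \<open>Bilinearity of the covariant derivative of \<open>\<pi>\<close> at a point\<close>

lemma chart_domain: "openin M V" "p \<in> V"
  using chart_of_mem[OF p] chart_openin by (auto simp: charts_at_def)

lemma E_vector_field: "vector_field C V (E u)"
  by (rule local_ext_vector_field[OF p])

text \<open>All extensions at \<open>p\<close> use the same chart, so \<open>local_ext\<close> is
  linear in the vector as an identity of fields. Linearity of \<open>deriv_along\<close> and
  \<open>N\<close> in their first arguments then carries over.\<close>

lemma nabla_form_linear_left:
  assumes "Y \<in> tangent_space C p"
  shows "linear_on (tangent_space C p) (\<lambda>X. nab X Y)"
proof -
  note sm = form_smooth[OF chart_domain(1) E_vector_field]
  have N: "N (E X) (E Y) p \<in> tangent_space C p" for X
    by (intro vector_field_at[OF _ chart_domain(2)] N_vector_field[OF chart_domain(1)] E_vector_field)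
  show ?thesis
    unfolding linear_on_def nabla_form_def cov_deriv_form_def
  proof (intro conjI ballI allI)
    fix X X'
    have "deriv_along C (E (X + X')) (\<lambda>q. \<pi> q (E Y q)) p
        = 1 * deriv_along C (E X) (\<lambda>q. \<pi> q (E Y q)) p
        + 1 * deriv_along C (E X') (\<lambda>q. \<pi> q (E Y q)) p"
      by (rule deriv_along_linear[OF sm chart_domain]) (simp add: local_ext_add[OF p])
    moreover have "N (E (X + X')) (E Y) p = N (E X) (E Y) p + N (E X') (E Y) p"
      by (simp add: local_ext_add[OF p] N_add_left[OF chart_domain(1)] E_vector_field chart_domain(2))
    ultimately show "deriv_along C (E (X + X')) (\<lambda>q. \<pi> q (E Y q)) p - \<pi> p (N (E (X + X')) (E Y) p)
      = deriv_along C (E X) (\<lambda>q. \<pi> q (E Y q)) p - \<pi> p (N (E X) (E Y) p)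
      + (deriv_along C (E X') (\<lambda>q. \<pi> q (E Y q)) p - \<pi> p (N (E X') (E Y) p))"
      by (simp add: linear_on_add[OF form_linear[OF p]] N)
  next
    fix a X
    have "deriv_along C (E (a *\<^sub>R X)) (\<lambda>q. \<pi> q (E Y q)) p
        = a * deriv_along C (E X) (\<lambda>q. \<pi> q (E Y q)) p
        + 0 * deriv_along C (E X) (\<lambda>q. \<pi> q (E Y q)) p"
      by (rule deriv_along_linear[OF sm chart_domain]) (simp add: local_ext_scaleR[OF p])
    moreover have "N (E (a *\<^sub>R X)) (E Y) p = a *\<^sub>R N (E X) (E Y) p"
      by (simp add: local_ext_scaleR[OF p] N_scaleR_left[OF chart_domain(1)] E_vector_field chart_domain(2))
    ultimately show "deriv_along C (E (a *\<^sub>R X)) (\<lambda>q. \<pi> q (E Y q)) p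
        - \<pi> p (N (E (a *\<^sub>R X)) (E Y) p)
      = a *\<^sub>R (deriv_along C (E X) (\<lambda>q. \<pi> q (E Y q)) p - \<pi> p (N (E X) (E Y) p))"
      by (simp add: linear_on_scaleR[OF form_linear[OF p]] N algebra_simps)
  qed
qed

text \<open>The extension of the second argument stands under the derivative, so linearity of the
  form is needed at every \<open>q\<close> of the chart domain and not just at \<open>p\<close>; the
  sum and product with a constant are split off before differentiating.\<close>

lemma nabla_form_linear_right:
  assumes "X \<in> tangent_space C p"
  shows "linear_on (tangent_space C p) (nab X)"
proof -
  note sm = form_smooth[OF chart_domain(1) E_vector_field]
  have N: "N (E X) (E Y) p \<in> tangent_space C p" for Y
    by (intro vector_field_at[OF _ chart_domain(2)] N_vector_field[OF chart_domain(1)] E_vector_field)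
  have lin: "linear_on (tangent_space C q) (\<pi> q)" if "q \<in> V" for q
    using that chart_domain(1) openin_subset by (intro form_linear) blast
  note Eq = vector_field_at[OF E_vector_field]
  show ?thesis
    unfolding linear_on_def nabla_form_def cov_deriv_form_def
  proof (intro conjI ballI allI)
    fix Y Y'
    have "deriv_along C (E X) (\<lambda>q. \<pi> q (E (Y + Y') q)) p
        = deriv_along C (E X) (\<lambda>q. \<pi> q (E Y q) + \<pi> q (E Y' q)) p"
      by (rule deriv_along_cong[OF chart_domain]) (simp add: local_ext_add[OF p] linear_on_add[OF lin] Eq)
    also have "\<dots> = deriv_along C (E X) (\<lambda>q. \<pi> q (E Y q)) p
        + deriv_along C (E X) (\<lambda>q. \<pi> q (E Y' q)) p"
      by (rule deriv_along_add[OF sm sm chart_domain])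
    moreover have "N (E X) (E (Y + Y')) p = N (E X) (E Y) p + N (E X) (E Y') p"
      by (simp add: local_ext_add[OF p] N_add_right[OF chart_domain(1)] E_vector_field chart_domain(2))
    ultimately show "deriv_along C (E X) (\<lambda>q. \<pi> q (E (Y + Y') q)) p
        - \<pi> p (N (E X) (E (Y + Y')) p)
      = deriv_along C (E X) (\<lambda>q. \<pi> q (E Y q)) p - \<pi> p (N (E X) (E Y) p)
      + (deriv_along C (E X) (\<lambda>q. \<pi> q (E Y' q)) p - \<pi> p (N (E X) (E Y') p))"
      by (simp add: linear_on_add[OF form_linear[OF p]] N)
  next
    fix a Y
    have "deriv_along C (E X) (\<lambda>q. \<pi> q (E (a *\<^sub>R Y) q)) p
        = deriv_along C (E X) (\<lambda>q. a * \<pi> q (E Y q)) p"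
      by (rule deriv_along_cong[OF chart_domain])
        (simp add: local_ext_scaleR[OF p] linear_on_scaleR[OF lin] Eq)
    also have "\<dots> = a * deriv_along C (E X) (\<lambda>q. \<pi> q (E Y q)) p"
      by (rule deriv_along_mult[OF sm chart_domain])
    moreover have "N (E X) (E (a *\<^sub>R Y)) p = a *\<^sub>R N (E X) (E Y) p"
      by (simp add: local_ext_scaleR[OF p] N_scaleR_right[OF chart_domain(1)] E_vector_field chart_domain(2))
    ultimately show "deriv_along C (E X) (\<lambda>q. \<pi> q (E (a *\<^sub>R Y) q)) p
        - \<pi> p (N (E X) (E (a *\<^sub>R Y)) p)
      = a *\<^sub>R (deriv_along C (E X) (\<lambda>q. \<pi> q (E Y q)) p - \<pi> p (N (E X) (E Y) p))"
      by (simp add: linear_on_scaleR[OF form_linear[OF p]] N algebra_simps)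
  qed
qed

text \<open>An isometry with square minus the identity is skew for the metric. In the chart basis,
  with Gram matrix \<open>G\<close>, this becomes the hypothesis of
  \<open>trace_eq_0_if_skew\<close>.\<close>

lemma tangent_trace_A: "tangent_trace C p (A p) = 0"
proof -
  let ?c = "chart_of C p"
  note c = chart_of_mem[OF p]
  define b where "b x y = g p (tangent_of C p ?c x) (tangent_of C p ?c y)" for x y
  define J where "J x = A p (tangent_of C p ?c x) ?c" for x
  define G :: "real^'n^'n" where "G = (\<chi> i j. b (axis i 1) (axis j 1))"
  have met: "linear_on (tangent_space C p) (g p u)" "u \<noteq> 0 \<Longrightarrow> g p u u > 0"
    "v \<in> tangent_space C p \<Longrightarrow> g p u v = g p v u"
    if "u \<in> tangent_space C p" for u v
    using kaehler that p by (auto simp: kaehler_manifold_def riemannian_metric_def)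
  have sym: "b x y = b y x" for x y
    unfolding b_def by (intro met tangent_of_mem c)
  have lin: "linear (b x)" for x
    unfolding b_def by (intro linear_tangent_of c met tangent_of_mem)
  have expand: "b x y = (\<Sum>i\<in>UNIV. y $ i * b x (axis i 1))" for x y
  proof -
    have "b x y = b x (\<Sum>i\<in>UNIV. y $ i *\<^sub>R axis i 1)"
      using basis_expansion[of y] by (simp add: scalar_mult_eq_scaleR)
    then show ?thesis by (simp add: linear_sum[OF lin] linear_scale[OF lin])
  qed
  have to_J: "tangent_of C p ?c (J x) = A p (tangent_of C p ?c x)" for x
    unfolding J_def by (intro tangent_of_component c A_mem p tangent_of_mem)
  have JJ: "J (J x) = - x" for x
  proof -
    have "J (J x) = A p (A p (tangent_of C p ?c x)) ?c"
      using to_J[of x] unfolding J_def[of "J x"] by simp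
    then show ?thesis by (simp add: A_A p tangent_of_mem c tangent_of_self)
  qed
  have bJ: "b (J x) (J y) = b x y" for x y
    using kaehler p c by (simp add: b_def to_J kaehler_manifold_def tangent_of_mem)
  \<comment> \<open>Put \<open>J y\<close> for \<open>y\<close> in \<open>bJ\<close> and use
    \<open>JJ\<close>.\<close>
  have skew: "b x (J y) = - b (J x) y" for x y
    using bJ[of x "J y"] JJ[of y] linear_neg[OF lin] by simp
  have "invertible G"
  proof -
    \<comment> \<open>A kernel vector of the Gram matrix is orthogonal to all basis vectors, hence
      to itself, and positivity of the metric makes it zero.\<close>
    have "x = 0" if "G *v x = 0" for x
    proof -
      have "b (axis i 1) x = 0" for i
        using arg_cong[OF that, of "\<lambda>v. v $ i"]
        by (simp add: expand[of "axis i 1" x] G_def matrix_vector_mult_def mult.commute)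
      then have "b x (axis i 1) = 0" for i by (subst sym)
      then have "b x x = 0" by (subst expand) simp
      then have "tangent_of C p ?c x = 0"
        using met(2)[OF tangent_of_mem[OF c, of x]] unfolding b_def by (metis less_irrefl)
      then show ?thesis by (simp add: tangent_of_eq_0_iff[OF c])
    qed
    then have "\<exists>B. B ** G = mat 1" by (simp add: matrix_left_invertible_ker)
    then show ?thesis by (simp add: invertible_left_inverse)
  qed
  moreover have "G ** matrix J = - (transpose (matrix J) ** G)"
  proof -
    have "(G ** matrix J) $ i $ j = b (axis i 1) (J (axis j 1))" for i j
      by (simp add: expand[of _ "J _"] G_def matrix_matrix_mult_def matrix_def mult.commute)
    moreover have "(transpose (matrix J) ** G) $ i $ j = b (J (axis i 1)) (axis j 1)" for i j
    proof -
      \<comment> \<open>\<open>expand\<close> resolves the second slot only, so symmetry is applied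
        before it and again inside the sum.\<close>
      have "b (J (axis i 1)) (axis j 1) = (\<Sum>k\<in>UNIV. J (axis i 1) $ k * b (axis j 1) (axis k 1))"
        by (subst sym) (rule expand)
      also have "\<dots> = (\<Sum>k\<in>UNIV. J (axis i 1) $ k * b (axis k 1) (axis j 1))"
        by (rule sum.cong[OF refl]) (subst sym, rule refl)
      finally show ?thesis by (simp add: G_def matrix_matrix_mult_def matrix_def transpose_def)
    qed
    ultimately show ?thesis by (simp add: vec_eq_iff skew)
  qed
  ultimately have "trace (matrix J) = 0" by (rule trace_eq_0_if_skew)
  then show ?thesis by (simp add: tangent_trace_def Let_def J_def[abs_def])
qed

section \<open>Explicit traces of the curvature tensors\<close>

abbreviation "R \<equiv> riem C N p"
abbreviation "Ric Y Z \<equiv> tangent_trace C p (\<lambda>X. R X Y Z)"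
abbreviation "Ric' X Y \<equiv> tangent_trace C p (R X Y)"

lemma form_A_linear: "linear_on (tangent_space C p) (\<lambda>X. \<pi> p (A p X))"
  using form_linear[OF p] A_linear[OF p] A_mem[OF p] by (simp add: linear_on_def)

text \<open>Moves the minus signs produced by \<open>A_A\<close> out of \<open>A\<close>,
  \<open>\<pi>\<close> and the covariant derivative, so that the coefficient identities in
  \<open>H0_eq\<close> become scalar algebra.\<close>

lemma uminus_simps:
  assumes "X \<in> tangent_space C p"
  shows "A p (- X) = - A p X" "\<pi> p (- X) = - \<pi> p X"
    "Y \<in> tangent_space C p \<Longrightarrow> nab X (- Y) = - nab X Y"
    "Y \<in> tangent_space C p \<Longrightarrow> nab (- X) Y = - nab X Y"
  using linear_on_uminus[OF A_linear[OF p] assms] linear_on_uminus[OF form_linear[OF p] assms]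
    linear_on_uminus[OF nabla_form_linear_right[OF assms]]
    linear_on_uminus[OF nabla_form_linear_left _] assms
  by blast+

text \<open>Supplies the linear functionals for \<open>tangent_trace_rank_one\<close> when the
  traced vector sits in the first slot; \<open>D_linear_right\<close> does so for the
  second.\<close>

lemma D_linear_left:
  assumes "Y \<in> tangent_space C p"
  shows "linear_on (tangent_space C p) (\<lambda>X. D0 p X Y)"
    "linear_on (tangent_space C p) (\<lambda>X. D1 p X Y)"
    "linear_on (tangent_space C p) (\<lambda>X. D2 p X Y)"
proof -
  note lin = nabla_form_linear_left[OF assms] nabla_form_linear_right[OF assms]
    form_linear[OF p] form_A_linear
  show "linear_on (tangent_space C p) (\<lambda>X. D0 p X Y)"
    "linear_on (tangent_space C p) (\<lambda>X. D1 p X Y)"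
    "linear_on (tangent_space C p) (\<lambda>X. D2 p X Y)"
    using lin by (simp_all add: D0_def D1_def D2_def linear_on_def algebra_simps add_divide_distrib)
qed

lemma D_linear_right:
  assumes "X \<in> tangent_space C p"
  shows "linear_on (tangent_space C p) (D0 p X)"
    "linear_on (tangent_space C p) (D3 p X)"
proof -
  note lin = nabla_form_linear_right[OF assms] form_linear[OF p] form_A_linear
  show "linear_on (tangent_space C p) (D0 p X)"
    "linear_on (tangent_space C p) (D3 p X)"
    using lin by (simp_all add: D0_def D3_def linear_on_def algebra_simps add_divide_distrib)
qed

text \<open>The term in \<open>A p X\<close> has trace zero, and the other \<open>D0\<close> terms
  are of rank one. In the last term of \<open>R0\<close> the identity contributes the dimension and
  the rank-one part subtracts 1, whence the factor \<open>real CARD('n) - 1\<close>.\<close>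

lemma Ric0_eq:
  assumes "Y \<in> tangent_space C p" "Z \<in> tangent_space C p"
  shows "Ric0 p Y Z = Ric Y Z - 1/2 * (D0 p (A p Z) Y - D0 p Y (A p Z))
    - 1/2 * D0 p (A p Y) Z + (real CARD('n) - 1) / 4 * \<pi> p Z * \<pi> p Y"
proof -
  have "tangent_trace C p (\<lambda>X. (1/2 * (D0 p X Y - D0 p Y X)) *\<^sub>R A p Z)
      = 1/2 * (D0 p (A p Z) Y - D0 p Y (A p Z))"
    using assms D_linear_left(1)[OF assms(1)] D_linear_right(1)[OF assms(1)]
    by (intro tangent_trace_rank_one linear_on_mult linear_on_diff p A_mem)
  moreover have "tangent_trace C p (\<lambda>X. (1/2 * D0 p X Z) *\<^sub>R A p Y) = 1/2 * D0 p (A p Y) Z"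
    using assms D_linear_left(1)[OF assms(2)]
    by (intro tangent_trace_rank_one linear_on_mult p A_mem)
  moreover have "tangent_trace C p (\<lambda>X. \<pi> p X *\<^sub>R Y) = \<pi> p Y"
    using assms by (intro tangent_trace_rank_one p form_linear)
  ultimately show ?thesis
    unfolding Ric0_def R0_def tangent_trace_add tangent_trace_diff tangent_trace_scaleR
    by (simp add: tangent_trace_A tangent_trace_id[OF p] field_simps)
qed

lemma Ric1_eq:
  assumes "Y \<in> tangent_space C p" "Z \<in> tangent_space C p"
  shows "Ric1 p Y Z = Ric Y Z - D1 p (A p Z) Y"
  using tangent_trace_rank_one[OF p D_linear_left(2)[OF assms(1)] A_mem[OF p assms(2)]]
  unfolding Ric1_def R1_def tangent_trace_diff by simp

text \<open>Here the \<open>D2\<close> term is of rank one, while the \<open>D3\<close> term is a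
  multiple of \<open>A\<close> and so has trace zero.\<close>

lemma Ric3_eq:
  assumes "Y \<in> tangent_space C p" "Z \<in> tangent_space C p"
  shows "Ric3 p Y Z = Ric Y Z - D2 p (A p Z) Y"
  using tangent_trace_rank_one[OF p D_linear_left(3)[OF assms(1)] A_mem[OF p assms(2)]]
  unfolding Ric3_def R3_def tangent_trace_add tangent_trace_diff tangent_trace_scaleR
  by (simp add: tangent_trace_A)

text \<open>The trace runs through the third argument, so the roles are exchanged: the
  \<open>D2\<close> term is a multiple of \<open>A\<close>, and the \<open>D3\<close> term is of
  rank one.\<close>

lemma R3'_eq:
  assumes "X \<in> tangent_space C p" "Y \<in> tangent_space C p"
  shows "R3' p X Y = Ric' X Y + D3 p Y (A p X)"
  using tangent_trace_rank_one[OF p D_linear_right(2)[OF assms(2)] A_mem[OF p assms(1)]]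
  unfolding R3'_def R3_def tangent_trace_add tangent_trace_diff tangent_trace_scaleR
  by (simp add: tangent_trace_A)

text \<open>The right-hand side is free of \<open>\<pi>\<close>. The coefficients of the five
  vectors are treated separately; \<open>X\<close> and \<open>Y\<close> enter antisymmetrically, so
  three identities suffice.\<close>

lemma H0_eq:
  assumes T: "X \<in> tangent_space C p" "Y \<in> tangent_space C p" "Z \<in> tangent_space C p"
  defines "k \<equiv> 1 / (4 * (real CARD('n) - 1))"
  shows "H0 p X Y Z = R X Y Z
    + (k * (2 * Ric X Z - Ric Z X - Ric' (A p Z) (A p X))) *\<^sub>R Y
    - (k * (2 * Ric Y Z - Ric Z Y - Ric' (A p Z) (A p Y))) *\<^sub>R X
    + (1/2 * Ric Y (A p X)) *\<^sub>R A p Z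
    + (1/4 * (Ric Z (A p X) - Ric' (A p Z) X)) *\<^sub>R A p Y
    - (1/4 * (Ric Z (A p Y) - Ric' (A p Z) Y)) *\<^sub>R A p X"
proof -
  have "CARD('n) \<ge> 4" using kaehler by (simp add: kaehler_manifold_def)
  then have k: "4 * k * (real CARD('n) - 1) = 1" by (simp add: k_def)
  \<comment> \<open>Writing all three denominators through \<open>k\<close> keeps the later algebra
    free of division; the dimension bound excludes a zero denominator.\<close>
  have k': "1 / (real CARD('n) - 1) = 4 * k" "1 / (2 * (real CARD('n) - 1)) = 2 * k"
    "1 / (4 * (real CARD('n) - 1)) = k"
    using \<open>CARD('n) \<ge> 4\<close> by (simp_all add: k_def divide_simps)
  note tensors = Ric0_eq Ric1_eq Ric3_eq R3'_eq D0_def D1_def D2_def D3_def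
    A_mem[OF p] A_A[OF p] uminus_simps T
  have YX: "4 * k * Ric0 p W Z - 2 * k * Ric1 p W Z - k * (Ric3 p Z W + R3' p (A p Z) (A p W))
      - 1/4 * \<pi> p Z * \<pi> p W = k * (2 * Ric W Z - Ric Z W - Ric' (A p Z) (A p W))"
    if W: "W \<in> tangent_space C p" for W
  proof -
    \<comment> \<open>The antisymmetric part of \<open>D0\<close> is \<open>D1\<close>, so those
      parts of \<open>Ric0\<close> and \<open>Ric1\<close> cancel. The remaining
      \<open>-2 * D0 p (A p W) Z\<close> cancels against the contributions of \<open>D2\<close> and
      \<open>D3\<close>. Only the quadratic term with the factor \<open>real CARD('n) - 1\<close>
      survives; times \<open>k\<close> it is the quarter that \<open>R0\<close> contributes with the
      opposite sign.\<close>
    have "4 * Ric0 p W Z - 2 * Ric1 p W Z - (Ric3 p Z W + R3' p (A p Z) (A p W))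
      = (2 * Ric W Z - Ric Z W - Ric' (A p Z) (A p W)) + (real CARD('n) - 1) * \<pi> p Z * \<pi> p W"
      using W by (simp add: tensors) (simp add: field_simps)
    from arg_cong[OF this, of "(*) k"]
    have "k * (4 * Ric0 p W Z - 2 * Ric1 p W Z - (Ric3 p Z W + R3' p (A p Z) (A p W)))
      = k * (2 * Ric W Z - Ric Z W - Ric' (A p Z) (A p W))
        + 1/4 * (4 * k * (real CARD('n) - 1)) * (\<pi> p Z * \<pi> p W)"
      by (simp add: algebra_simps)
    then show ?thesis unfolding k by (simp add: algebra_simps)
  qed
  \<comment> \<open>Since \<open>A\<close> squares to minus the identity, the two traces contribute
    a quarter of \<open>D2 p W Z + D3 p W Z\<close>, and that sum is
    \<open>2 * D0 p W Z\<close>.\<close>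
  have AYX: "1/4 * Ric3 p Z (A p W) - 1/4 * R3' p (A p Z) W - 1/2 * D0 p W Z
      = 1/4 * (Ric Z (A p W) - Ric' (A p Z) W)"
    if W: "W \<in> tangent_space C p" for W
    using W by (simp add: tensors) (simp add: field_simps)
  \<comment> \<open>By \<open>A_A\<close> the trace contributes \<open>1/2 * D1 p X Y\<close>,
    exactly half the antisymmetric part of \<open>D0\<close>.\<close>
  have AZ: "1/2 * Ric1 p Y (A p X) - 1/2 * (D0 p X Y - D0 p Y X) = 1/2 * Ric Y (A p X)"
    by (simp add: tensors) (simp add: field_simps)
  \<comment> \<open>The identities are used from right to left: the \<open>\<pi>\<close>-free
    coefficients are expanded back into those of \<open>H0\<close>, so that only collecting
    coefficients of vectors is left.\<close>
  show ?thesis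
    unfolding YX[OF T(1), symmetric] YX[OF T(2), symmetric] AYX[OF T(1), symmetric]
      AYX[OF T(2), symmetric] AZ[symmetric] H0_def R0_def Let_def k'
    by (simp add: algebra_simps)
qed

end

end

theorem theorem4p11:
  fixes M :: "'m topology" and C :: "('m, 'n::finite) chart set"
    and g :: "'m \<Rightarrow> ('m, 'n) tvec \<Rightarrow> ('m, 'n) tvec \<Rightarrow> real"
    and A :: "'m \<Rightarrow> ('m, 'n) tvec \<Rightarrow> ('m, 'n) tvec"
    and N N1 N1' :: "('m, 'n) vfield \<Rightarrow> ('m, 'n) vfield \<Rightarrow> ('m, 'n) vfield"
    and \<pi> \<pi>' :: "'m \<Rightarrow> ('m, 'n) tvec \<Rightarrow> real"
  assumes "kaehler_manifold M C g A N"
    and "one_form M C \<pi>" and "quarter_symmetric M C A N \<pi> N1"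
    and "one_form M C \<pi>'" and "quarter_symmetric M C A N \<pi>' N1'"
  shows "\<forall>p\<in>topspace M. \<forall>X\<in>tangent_space C p. \<forall>Y\<in>tangent_space C p. \<forall>Z\<in>tangent_space C p.
    quarter_symmetric_tensors.H0 C A N \<pi> p X Y Z
      = quarter_symmetric_tensors.H0 C A N \<pi>' p X Y Z"
proof -
  have "smooth_manifold M C" using assms(1) by (simp add: kaehler_manifold_def)
  then have "kaehler_one_form M C A N \<pi> g" "kaehler_one_form M C A N \<pi>' g"
    using assms by (auto simp: kaehler_one_form_def manifold_def kaehler_one_form_axioms_def)
  \<comment> \<open>By \<open>H0_eq\<close> both tensors equal the same expression in
    \<open>C\<close>, \<open>A\<close> and \<open>N\<close>.\<close>
  then show ?thesis by (simp add: kaehler_one_form.H0_eq)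
qed

end
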